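(* Let $q_{ij}\in\mathbb{C}$ ($1\le i,j\le 4$) be $4$-th roots of unity with $q_{ii}=q_{ij}q_{ji}=1$ such that $\prod_{i=1}^4 q_{ij}$ is independent of $j$, and let $$A_4=\mathbb{C}\langle x_1,\dots,x_4\rangle\big/\Big(\textstyle\sum_{k=1}^4x_k^4,\ x_ix_j-q_{ij}x_jx_i\Big)_{i,j}$$ (so that $\mathrm{proj}(A_4)$ is a non-commutative Fermat quartic K3 surface). Then $\mathrm{Hilb}^1(A_4)$ is either a quartic K3 surface or $24$ distinct points. In particular its Euler number is $24$, independently of the values of the $q_{ij}$.
   Context: A $1$-point module over a graded algebra $A$ generated in degree $1$ is a cyclic graded right $A$-module generated in degree $0$ with Hilbert series $1/(1-t)$; $\mathrm{Hilb}^1(A)$ is the set (scheme) of isomorphism classes of such modules, identified as a subset of sequences of points of $\mathbb{P}^{3}$ via $m_ix_j=\xi_{i,j}m_{i+1}$, $[\xi_{i,1}:\dots:\xi_{i,4}]\in\mathbb{P}^3$. *)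

theory Defs
  imports "HOL-Analysis.Analysis"
begin

text \<open>Coordinates of \<open>\<complex>\<^sup>4\<close> are indexed by the numeral type \<open>4\<close>
  (standing for the indices 1..4 of the paper).\<close>

type_synonym cvec4 = "complex ^ 4"

definition proj_class :: "cvec4 \<Rightarrow> cvec4 set" where
  "proj_class v = {w. \<exists>c::complex. c \<noteq> 0 \<and> w = (\<chi> k. c * v $ k)}"

text \<open>A sequence of representatives \<open>\<xi>\<^sub>n\<close> defines a 1-point module over \<open>A\<^sub>4\<close>
  (via \<open>m\<^sub>n x\<^sub>j = \<xi>\<^sub>n\<^sub>,\<^sub>j m\<^sub>n\<^sub>+\<^sub>1\<close>) iff all defining relations of \<open>A\<^sub>4\<close> act as zero.\<close>
definition point_seq :: "(4 \<Rightarrow> 4 \<Rightarrow> complex) \<Rightarrow> (nat \<Rightarrow> cvec4) \<Rightarrow> bool" where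
  "point_seq q \<xi> \<longleftrightarrow>
     (\<forall>n. \<xi> n \<noteq> 0) \<and>
     (\<forall>n i j. \<xi> n $ i * \<xi> (Suc n) $ j - q i j * (\<xi> n $ j * \<xi> (Suc n) $ i) = 0) \<and>
     (\<forall>n. (\<Sum>k\<in>UNIV. \<xi> n $ k * \<xi> (n+1) $ k * \<xi> (n+2) $ k * \<xi> (n+3) $ k) = 0)"

definition Hilb1 :: "(4 \<Rightarrow> 4 \<Rightarrow> complex) \<Rightarrow> (nat \<Rightarrow> cvec4 set) set" where
  "Hilb1 q = {P. \<exists>\<xi>. point_seq q \<xi> \<and> (\<forall>n. P n = proj_class (\<xi> n))}"

text \<open>Homogeneous quartic forms in 4 variables, given by coefficients on exponent vectors.\<close>
definition quartic_monos :: "(4 \<Rightarrow> nat) set" where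
  "quartic_monos = {\<alpha>. sum \<alpha> UNIV = 4}"

definition quartic_eval :: "((4 \<Rightarrow> nat) \<Rightarrow> complex) \<Rightarrow> cvec4 \<Rightarrow> complex" where
  "quartic_eval c v = (\<Sum>\<alpha>\<in>quartic_monos. c \<alpha> * (\<Prod>k\<in>UNIV. v $ k ^ \<alpha> k))"

definition quartic_partial :: "((4 \<Rightarrow> nat) \<Rightarrow> complex) \<Rightarrow> 4 \<Rightarrow> cvec4 \<Rightarrow> complex" where
  "quartic_partial c l v = (\<Sum>\<alpha>\<in>quartic_monos. c \<alpha> * of_nat (\<alpha> l) *
      (\<Prod>k\<in>UNIV. v $ k ^ (if k = l then \<alpha> k - 1 else \<alpha> k)))"

text \<open>A smooth quartic surface in \<open>\<P>\<^sup>3\<close> (i.e. a quartic K3 surface): nonzero form with no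
  singular point.\<close>
definition smooth_quartic :: "((4 \<Rightarrow> nat) \<Rightarrow> complex) \<Rightarrow> bool" where
  "smooth_quartic c \<longleftrightarrow> (\<exists>\<alpha>\<in>quartic_monos. c \<alpha> \<noteq> 0) \<and>
     (\<forall>v. v \<noteq> 0 \<longrightarrow> quartic_eval c v = 0 \<longrightarrow> (\<exists>l. quartic_partial c l v \<noteq> 0))"

definition quartic_zero_set :: "((4 \<Rightarrow> nat) \<Rightarrow> complex) \<Rightarrow> cvec4 set set" where
  "quartic_zero_set c = {proj_class v | v. v \<noteq> 0 \<and> quartic_eval c v = 0}"

end

theory Submission
  imports Defs
begin

text \<open>
  For a point sequence, the relations x_i x_j = q_ij x_j x_i keep the support of xi_n constant and
  make xi_n proportional to (q_ik^n xi_0k)_k for every i in the support. Hence a point of Hilb^1 is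
  determined by its first point, and the quartic relation turns into sum_k q_ik^2 xi_0k^4 = 0.
  The column condition forces the triangle products q_ij q_jk q_ki over distinct indices to be
  either all 1 or all different from 1. In the first case q_ik = q_1k / q_1i, and Hilb^1 is the
  smooth diagonal quartic sum_k q_1k^2 x_k^4 = 0. In the second case a support of three indices
  would give a trivial triangle and a single index violates the quartic relation, so the support
  is a pair {i, j} with x_j / x_i a fourth root of -q_ij^2: 6 * 4 = 24 points.
\<close>

lemma proj_class_eq: "proj_class v = {c *s v | c. c \<noteq> 0}"
  unfolding proj_class_def by (auto simp: vec_eq_iff)

lemma proj_class_smult:
  assumes "a \<noteq> 0" shows "proj_class (a *s v) = proj_class v"
proof (intro set_eqI iffI)
  fix w assume "w \<in> proj_class (a *s v)"
  then obtain c where "c \<noteq> 0" "w = c *s (a *s v)" unfolding proj_class_eq by blast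
  then have "c * a \<noteq> 0" "w = (c * a) *s v" using assms by simp_all
  then show "w \<in> proj_class v" unfolding proj_class_eq by blast
next
  fix w assume "w \<in> proj_class v"
  then obtain c where "c \<noteq> 0" "w = c *s v" unfolding proj_class_eq by blast
  then have "c / a \<noteq> 0" "w = (c / a) *s (a *s v)" using assms by simp_all
  then show "w \<in> proj_class (a *s v)" unfolding proj_class_eq by blast
qed

lemma proj_class_eq_imp_smult:
  assumes "proj_class v = proj_class w" shows "\<exists>c. c \<noteq> 0 \<and> w = c *s v"
proof -
  have "w \<in> proj_class w" unfolding proj_class_eq by (auto intro: exI[of _ 1])
  then show ?thesis using assms unfolding proj_class_eq by auto
qed

definition orbit_seq :: "('n \<Rightarrow> complex) \<Rightarrow> complex ^ 'n \<Rightarrow> nat \<Rightarrow> complex ^ 'n" where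
  "orbit_seq a v n = (\<chi> k. a k ^ n * v $ k)"

lemma orbit_seq_component [simp]: "orbit_seq a v n $ k = a k ^ n * v $ k"
  by (simp add: orbit_seq_def)

lemma orbit_seq_0 [simp]: "orbit_seq a v 0 = v"
  by (simp add: vec_eq_iff)

lemma orbit_seq_smult: "orbit_seq a (c *s v) n = c *s orbit_seq a v n"
  by (simp add: vec_eq_iff mult_ac)

lemma orbit_seq_quartic_term:
  assumes "a k ^ 4 = 1"
  shows "orbit_seq a v n $ k * orbit_seq a v (n + 1) $ k * orbit_seq a v (n + 2) $ k
           * orbit_seq a v (n + 3) $ k = a k ^ 2 * v $ k ^ 4"
proof -
  have "a k ^ n * a k ^ (n + 1) * a k ^ (n + 2) * a k ^ (n + 3) = a k ^ (4 * (n + 1) + 2)"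
    by (simp only: power_add [symmetric]) (simp add: algebra_simps)
  also have "\<dots> = (a k ^ 4) ^ (n + 1) * a k ^ 2"
    by (simp only: power_add power_mult)
  finally have powers: "a k ^ n * a k ^ (n + 1) * a k ^ (n + 2) * a k ^ (n + 3) = a k ^ 2"
    using assms by simp
  have factor: "(x * w) * (y * w) * (z * w) * (u * w) = (x * y * z * u) * w ^ 4" for x y z u w :: complex
    by (simp add: power4_eq_xxxx mult_ac)
  show ?thesis by (simp only: orbit_seq_component factor powers)
qed

lemma point_seq_nonzero: "point_seq q \<xi> \<Longrightarrow> \<xi> n \<noteq> 0"
  unfolding point_seq_def by blast

lemma point_seq_commute:
  "point_seq q \<xi> \<Longrightarrow> \<xi> n $ i * \<xi> (Suc n) $ j = q i j * (\<xi> n $ j * \<xi> (Suc n) $ i)"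
  unfolding point_seq_def by (metis eq_iff_diff_eq_0)

lemma point_seq_quartic:
  "point_seq q \<xi> \<Longrightarrow> (\<Sum>k\<in>UNIV. \<xi> n $ k * \<xi> (n + 1) $ k * \<xi> (n + 2) $ k * \<xi> (n + 3) $ k) = 0"
  unfolding point_seq_def by blast

lemma point_seq_support_Suc:
  assumes "point_seq q \<xi>" shows "\<xi> (Suc n) $ i \<noteq> 0 \<longleftrightarrow> \<xi> n $ i \<noteq> 0"
proof
  assume "\<xi> (Suc n) $ i \<noteq> 0"
  then have "\<xi> n $ j = 0" if "\<xi> n $ i = 0" for j
    using point_seq_commute[OF assms, of n j i] that by simp
  then show "\<xi> n $ i \<noteq> 0" using point_seq_nonzero[OF assms, of n] by (auto simp: vec_eq_iff)
next
  assume "\<xi> n $ i \<noteq> 0"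
  then have "\<xi> (Suc n) $ j = 0" if "\<xi> (Suc n) $ i = 0" for j
    using point_seq_commute[OF assms, of n i j] that by simp
  then show "\<xi> (Suc n) $ i \<noteq> 0" using point_seq_nonzero[OF assms, of "Suc n"] by (auto simp: vec_eq_iff)
qed

lemma point_seq_support:
  "point_seq q \<xi> \<Longrightarrow> \<xi> n $ i \<noteq> 0 \<longleftrightarrow> \<xi> 0 $ i \<noteq> 0"
  by (induction n) (simp_all add: point_seq_support_Suc)

lemma point_seq_component:
  assumes "point_seq q \<xi>" and "\<xi> 0 $ i \<noteq> 0"
  shows "\<xi> 0 $ i * \<xi> n $ j = \<xi> n $ i * (q i j ^ n * \<xi> 0 $ j)"
proof (induction n)
  case (Suc n)
  have "\<xi> n $ i * (\<xi> 0 $ i * \<xi> (Suc n) $ j) = q i j * \<xi> (Suc n) $ i * (\<xi> 0 $ i * \<xi> n $ j)"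
    using point_seq_commute[OF assms(1), of n i j] by (simp add: mult_ac)
  also have "\<dots> = \<xi> n $ i * (\<xi> (Suc n) $ i * (q i j ^ Suc n * \<xi> 0 $ j))"
    using Suc.IH by (simp add: mult_ac)
  finally show ?case
    using point_seq_support[OF assms(1), of n i] assms(2) by simp
qed simp

lemma point_seq_eq_smult_orbit_seq:
  assumes "point_seq q \<xi>" and "\<xi> 0 $ i \<noteq> 0"
  shows "\<xi> n = (\<xi> n $ i / \<xi> 0 $ i) *s orbit_seq (q i) (\<xi> 0) n"
  using point_seq_component[OF assms, of n] assms(2)
  by (simp add: vec_eq_iff field_simps)

lemma proj_class_point_seq:
  assumes "point_seq q \<xi>" and "\<xi> 0 $ i \<noteq> 0"
  shows "proj_class (\<xi> n) = proj_class (orbit_seq (q i) (\<xi> 0) n)"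
proof -
  have "\<xi> n $ i / \<xi> 0 $ i \<noteq> 0"
    using point_seq_support[OF assms(1), of n i] assms(2) by simp
  then show ?thesis
    by (subst point_seq_eq_smult_orbit_seq[OF assms]) (rule proj_class_smult)
qed

lemma point_seq_weighted_quartic:
  assumes q4: "\<forall>k. q i k ^ 4 = 1" and \<xi>: "point_seq q \<xi>" and i: "\<xi> 0 $ i \<noteq> 0"
  shows "(\<Sum>k\<in>UNIV. q i k ^ 2 * \<xi> 0 $ k ^ 4) = 0"
proof -
  define v where "v = \<xi> 0"
  define c where "c n = \<xi> n $ i / v $ i" for n
  have c: "c n \<noteq> 0" for n
    using point_seq_support[OF \<xi>, of n i] i by (simp add: c_def v_def)
  have \<xi>_eq: "\<xi> n $ k = c n * orbit_seq (q i) v n $ k" for n k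
    unfolding c_def v_def by (subst point_seq_eq_smult_orbit_seq[OF \<xi> i]) simp
  have factor: "(x * p) * (y * r) * (z * s) * (u * t) = (x * y * z * u) * (p * r * s * t)"
    for x y z u p r s t :: complex
    by (simp add: mult_ac)
  have "0 = (\<Sum>k\<in>UNIV. \<xi> 0 $ k * \<xi> (0 + 1) $ k * \<xi> (0 + 2) $ k * \<xi> (0 + 3) $ k)"
    using point_seq_quartic[OF \<xi>, of 0] by simp
  also have "\<dots> = (c 0 * c (0 + 1) * c (0 + 2) * c (0 + 3)) * (\<Sum>k\<in>UNIV. q i k ^ 2 * v $ k ^ 4)"
    by (simp only: \<xi>_eq factor orbit_seq_quartic_term q4[rule_format] sum_distrib_left)
  finally show ?thesis using c by (simp add: v_def)
qed

lemma point_seq_orbit_seq: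
  assumes a4: "\<forall>k. a k ^ 4 = 1" and "v \<noteq> 0"
    and compatible: "\<forall>i j. v $ i \<noteq> 0 \<longrightarrow> v $ j \<noteq> 0 \<longrightarrow> a j = q i j * a i"
    and weighted: "(\<Sum>k\<in>UNIV. a k ^ 2 * v $ k ^ 4) = 0"
  shows "point_seq q (orbit_seq a v)"
  unfolding point_seq_def
proof (intro conjI allI)
  fix n
  obtain k where "v $ k \<noteq> 0" using \<open>v \<noteq> 0\<close> by (auto simp: vec_eq_iff)
  moreover have "a k \<noteq> 0" using a4[rule_format, of k] by auto
  ultimately show "orbit_seq a v n \<noteq> 0" by (auto simp: vec_eq_iff)
next
  fix n i j
  have "orbit_seq a v n $ i * orbit_seq a v (Suc n) $ j - q i j * (orbit_seq a v n $ j * orbit_seq a v (Suc n) $ i)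
      = a i ^ n * a j ^ n * v $ i * v $ j * (a j - q i j * a i)"
    by (simp add: right_diff_distrib mult_ac)
  then show "orbit_seq a v n $ i * orbit_seq a v (Suc n) $ j - q i j * (orbit_seq a v n $ j * orbit_seq a v (Suc n) $ i) = 0"
    using compatible by auto
next
  fix n
  show "(\<Sum>k\<in>UNIV. orbit_seq a v n $ k * orbit_seq a v (n + 1) $ k * orbit_seq a v (n + 2) $ k
      * orbit_seq a v (n + 3) $ k) = 0"
    using weighted by (simp only: orbit_seq_quartic_term a4[rule_format])
qed

lemma point_seq_in_Hilb1: "point_seq q \<xi> \<Longrightarrow> (\<lambda>n. proj_class (\<xi> n)) \<in> Hilb1 q"
  unfolding Hilb1_def by blast

lemma inj_on_Hilb1_initial: "inj_on (\<lambda>P. P 0) (Hilb1 q)"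
proof (rule inj_onI)
  fix P P' assume "P \<in> Hilb1 q" "P' \<in> Hilb1 q" and "P 0 = P' 0"
  then obtain \<xi> \<xi>' where \<xi>: "point_seq q \<xi>" "\<And>n. P n = proj_class (\<xi> n)"
    and \<xi>': "point_seq q \<xi>'" "\<And>n. P' n = proj_class (\<xi>' n)"
    and "proj_class (\<xi> 0) = proj_class (\<xi>' 0)"
    unfolding Hilb1_def by auto
  then obtain c where c: "c \<noteq> 0" "\<xi>' 0 = c *s \<xi> 0" using proj_class_eq_imp_smult by blast
  obtain i where i: "\<xi> 0 $ i \<noteq> 0" using point_seq_nonzero[OF \<xi>(1), of 0] by (auto simp: vec_eq_iff)
  then have i': "\<xi>' 0 $ i \<noteq> 0" using c by simp
  show "P = P'"
  proof
    fix n
    have "P n = proj_class (c *s orbit_seq (q i) (\<xi> 0) n)"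
      using proj_class_point_seq[OF \<xi>(1) i] \<xi>(2) proj_class_smult[OF c(1)] by simp
    also have "\<dots> = P' n"
      using proj_class_point_seq[OF \<xi>'(1) i'] \<xi>'(2) c(2) by (simp add: orbit_seq_smult)
    finally show "P n = P' n" .
  qed
qed

definition fourth_power_exp :: "4 \<Rightarrow> 4 \<Rightarrow> nat" where
  "fourth_power_exp k = (\<lambda>l. if l = k then 4 else 0)"

definition diag_quartic :: "(4 \<Rightarrow> complex) \<Rightarrow> (4 \<Rightarrow> nat) \<Rightarrow> complex" where
  "diag_quartic w \<alpha> = (\<Sum>k\<in>UNIV. if \<alpha> = fourth_power_exp k then w k else 0)"

lemma finite_quartic_monos: "finite quartic_monos"
proof (rule finite_subset)
  show "quartic_monos \<subseteq> Pi\<^sub>E UNIV (\<lambda>_. {..4})"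
    unfolding quartic_monos_def by (auto simp: PiE_UNIV_domain intro: member_le_sum[of _ UNIV, simplified, THEN order_trans])
  show "finite (Pi\<^sub>E (UNIV :: 4 set) (\<lambda>_. {..4::nat}))" by (rule finite_PiE) auto
qed

lemma fourth_power_exp_in_quartic_monos: "fourth_power_exp k \<in> quartic_monos"
  unfolding quartic_monos_def fourth_power_exp_def by simp

lemma fourth_power_exp_inject: "fourth_power_exp k = fourth_power_exp l \<longleftrightarrow> k = l"
  unfolding fourth_power_exp_def by (metis zero_neq_numeral)

lemma sum_quartic_monos_diag_quartic:
  "(\<Sum>\<alpha>\<in>quartic_monos. diag_quartic w \<alpha> * g \<alpha>) = (\<Sum>k\<in>UNIV. w k * g (fourth_power_exp k))"
proof -
  have "(\<Sum>\<alpha>\<in>quartic_monos. diag_quartic w \<alpha> * g \<alpha>)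
      = (\<Sum>k\<in>UNIV. \<Sum>\<alpha>\<in>quartic_monos. if \<alpha> = fourth_power_exp k then w k * g \<alpha> else 0)"
    unfolding diag_quartic_def sum_distrib_right by (subst sum.swap) (auto intro!: sum.cong)
  also have "\<dots> = (\<Sum>k\<in>UNIV. w k * g (fourth_power_exp k))"
    by (simp only: sum.delta[OF finite_quartic_monos] fourth_power_exp_in_quartic_monos if_True)
  finally show ?thesis .
qed

lemma quartic_eval_diag_quartic: "quartic_eval (diag_quartic w) v = (\<Sum>k\<in>UNIV. w k * v $ k ^ 4)"
proof -
  have "(\<Prod>l\<in>UNIV. v $ l ^ fourth_power_exp k l) = v $ k ^ 4" for k
    by (simp add: fourth_power_exp_def if_distrib prod.If_cases)
  then show ?thesis
    unfolding quartic_eval_def sum_quartic_monos_diag_quartic by simp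
qed

lemma quartic_partial_diag_quartic: "quartic_partial (diag_quartic w) l v = 4 * w l * v $ l ^ 3"
proof -
  have coefficient: "of_nat (fourth_power_exp k l)
      * (\<Prod>m\<in>UNIV. v $ m ^ (if m = l then fourth_power_exp k m - 1 else fourth_power_exp k m))
      = (if k = l then 4 * v $ l ^ 3 else 0)" for k
  proof (cases "k = l")
    case True
    then show ?thesis by (simp add: fourth_power_exp_def if_distrib prod.If_cases)
  qed (simp add: fourth_power_exp_def)
  show ?thesis
    unfolding quartic_partial_def mult.assoc sum_quartic_monos_diag_quartic coefficient
    by (simp add: if_distrib mult_ac cong: if_cong)
qed

lemma smooth_quartic_diag_quartic:
  assumes "\<forall>k. w k \<noteq> 0" shows "smooth_quartic (diag_quartic w)"
  unfolding smooth_quartic_def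
proof (intro conjI allI impI)
  have "diag_quartic w (fourth_power_exp 1) = w 1"
    unfolding diag_quartic_def by (simp add: fourth_power_exp_inject)
  then show "\<exists>\<alpha>\<in>quartic_monos. diag_quartic w \<alpha> \<noteq> 0"
    using fourth_power_exp_in_quartic_monos assms by metis
  fix v :: cvec4 assume "v \<noteq> 0"
  then obtain l where "v $ l \<noteq> 0" by (auto simp: vec_eq_iff)
  then show "\<exists>l. quartic_partial (diag_quartic w) l v \<noteq> 0"
    using assms by (auto simp: quartic_partial_diag_quartic)
qed

definition trivial_triangle :: "('a \<Rightarrow> 'a \<Rightarrow> 'b::comm_monoid_mult) \<Rightarrow> 'a \<Rightarrow> 'a \<Rightarrow> 'a \<Rightarrow> bool" where
  "trivial_triangle q i j k \<longleftrightarrow> q i j * q j k * q k i = 1"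

lemma trivial_triangle_rotate: "trivial_triangle q i j k \<Longrightarrow> trivial_triangle q j k i"
  unfolding trivial_triangle_def by (simp add: mult_ac)

lemma trivial_triangle_swap:
  assumes "\<forall>i j. q i j * q j i = 1" and "trivial_triangle q i j k"
  shows "trivial_triangle q j i k"
proof -
  have "q j i * q i k * q k j = (q j i * q i k * q k j) * (q i j * q j k * q k i)"
    using assms(2) unfolding trivial_triangle_def by simp
  also have "\<dots> = (q i j * q j i) * (q j k * q k j) * (q k i * q i k)"
    by (simp add: mult_ac)
  finally show ?thesis using assms(1) unfolding trivial_triangle_def by simp
qed

lemma point_seq_trivial_triangle:
  assumes \<xi>: "point_seq q \<xi>" and "\<xi> 0 $ i \<noteq> 0" "\<xi> 0 $ j \<noteq> 0" "\<xi> 0 $ k \<noteq> 0"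
  shows "trivial_triangle q i j k"
proof -
  have cancel: "(a * b * c - 1) * (x1 * x2 * x3 * (y1 * y2 * y3)) = 0"
    if "x1 * y2 = a * (x2 * y1)" "x2 * y3 = b * (x3 * y2)" "x3 * y1 = c * (x1 * y3)"
    for x1 x2 x3 y1 y2 y3 a b c :: complex
    using that by algebra
  have "(q i j * q j k * q k i - 1)
      * (\<xi> 0 $ i * \<xi> 0 $ j * \<xi> 0 $ k * (\<xi> (Suc 0) $ i * \<xi> (Suc 0) $ j * \<xi> (Suc 0) $ k)) = 0"
    by (rule cancel[OF point_seq_commute[OF \<xi>, of 0 i j] point_seq_commute[OF \<xi>, of 0 j k]
      point_seq_commute[OF \<xi>, of 0 k i]])
  moreover have "\<xi> (Suc 0) $ i \<noteq> 0" "\<xi> (Suc 0) $ j \<noteq> 0" "\<xi> (Suc 0) $ k \<noteq> 0"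
    using assms(2-4) point_seq_support[OF \<xi>, of "Suc 0"] by blast+
  ultimately show ?thesis using assms(2-4) unfolding trivial_triangle_def by simp
qed

lemma UNIV_4_distinct:
  assumes "distinct [a, b, c, d :: 4]" shows "UNIV = {a, b, c, d}"
proof -
  have "card {a, b, c, d} = card (UNIV :: 4 set)" using assms by simp
  then show ?thesis using card_subset_eq[of UNIV "{a, b, c, d}"] by simp
qed

text \<open>Comparing the products of columns j and k shows that the triangles a j k and b j k have
  product q_jk^4 = 1.\<close>

lemma trivial_triangle_transfer:
  fixes q :: "4 \<Rightarrow> 4 \<Rightarrow> complex"
  assumes q4: "\<forall>i j. q i j ^ 4 = 1" and qd: "\<forall>i. q i i = 1" and qinv: "\<forall>i j. q i j * q j i = 1"
    and col: "\<forall>j j'. (\<Prod>i\<in>UNIV. q i j) = (\<Prod>i\<in>UNIV. q i j')"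
    and d: "distinct [a, b, j, k]" and a: "trivial_triangle q a j k"
  shows "trivial_triangle q b j k"
proof -
  have "q a j * (q b j * (q j j * q k j)) = q a k * (q b k * (q j k * q k k))"
    using col d by (simp add: UNIV_4_distinct[OF d])
  then have cols: "q a j * q b j * q k j = q a k * q b k * q j k"
    using qd by (simp add: mult_ac)
  have "q k j * q j k = 1" "q k a * q a k = 1" "q k b * q b k = 1" "q j k ^ 4 = 1"
    using qinv q4 by blast+
  with cols have "(q a j * q j k * q k a) * (q b j * q j k * q k b) = 1"
    by algebra
  with a show ?thesis unfolding trivial_triangle_def by simp
qed

lemma trivial_triangle_permute:
  assumes qinv: "\<forall>i j. q i j * q j i = 1" and "trivial_triangle q a b c"
    and "distinct [x, y, z]" and "{x, y, z} = {a, b, c}"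
  shows "trivial_triangle q x y z"
proof -
  note bca = trivial_triangle_rotate[OF assms(2)]
    and bac = trivial_triangle_swap[OF qinv assms(2)]
  note cab = trivial_triangle_rotate[OF bca] and acb = trivial_triangle_rotate[OF bac]
  note cba = trivial_triangle_rotate[OF acb]
  have "x \<in> {a, b, c}" "y \<in> {a, b, c}" "z \<in> {a, b, c}" using assms(4) by auto
  then show ?thesis using assms(2,3) bca bac cab acb cba by auto
qed

lemma exists_fourth_index:
  assumes "distinct [a, b, c :: 4]" obtains d where "distinct [a, b, c, d]"
proof -
  have "card {a, b, c} \<noteq> card (UNIV :: 4 set)" using assms by simp
  then have "{a, b, c} \<noteq> UNIV" by metis
  then obtain d where "d \<notin> {a, b, c}" by blast
  then show thesis using assms by (intro that[of d]) auto
qed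

lemma trivial_triangles_all_or_none:
  fixes q :: "4 \<Rightarrow> 4 \<Rightarrow> complex"
  assumes q4: "\<forall>i j. q i j ^ 4 = 1" and qd: "\<forall>i. q i i = 1" and qinv: "\<forall>i j. q i j * q j i = 1"
    and col: "\<forall>j j'. (\<Prod>i\<in>UNIV. q i j) = (\<Prod>i\<in>UNIV. q i j')"
  shows "(\<forall>i j k. distinct [i, j, k] \<longrightarrow> trivial_triangle q i j k)
       \<or> (\<forall>i j k. distinct [i, j, k] \<longrightarrow> \<not> trivial_triangle q i j k)"
proof (rule disjCI)
  assume "\<not> (\<forall>i j k. distinct [i, j, k] \<longrightarrow> \<not> trivial_triangle q i j k)"
  then obtain i j k where ijk: "distinct [i, j, k]" "trivial_triangle q i j k" by blast
  obtain l where l: "distinct [i, j, k, l]" by (rule exists_fourth_index[OF ijk(1)])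
  note transfer = trivial_triangle_transfer[OF q4 qd qinv col]
  note jki = trivial_triangle_rotate[OF ijk(2)]
  note kij = trivial_triangle_rotate[OF jki]
  have "trivial_triangle q l j k" "trivial_triangle q l k i" "trivial_triangle q l i j"
    using transfer[OF _ ijk(2)] transfer[OF _ jki] transfer[OF _ kij] l by auto
  note triangles = ijk(2) this
  \<comment> \<open>the triangles on the complements of l, i, j, k; every triangle permutes one of them\<close>
  show "\<forall>x y z. distinct [x, y, z] \<longrightarrow> trivial_triangle q x y z"
  proof (intro allI impI)
    fix x y z :: 4 assume xyz: "distinct [x, y, z]"
    then obtain w where w: "distinct [x, y, z, w]" by (rule exists_fourth_index)
    then have "{x, y, z} = UNIV - {w}" using UNIV_4_distinct[OF w] by auto
    moreover have "{i, j, k} = UNIV - {l}" "{l, j, k} = UNIV - {i}"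
      "{l, k, i} = UNIV - {j}" "{l, i, j} = UNIV - {k}"
      using UNIV_4_distinct[OF l] l by auto
    moreover have "w \<in> {i, j, k, l}" using UNIV_4_distinct[OF l] by auto
    ultimately show "trivial_triangle q x y z"
      using trivial_triangle_permute[OF qinv triangles(1) xyz]
        trivial_triangle_permute[OF qinv triangles(2) xyz]
        trivial_triangle_permute[OF qinv triangles(3) xyz]
        trivial_triangle_permute[OF qinv triangles(4) xyz]
      by auto
  qed
qed

lemma trivial_triangles_imp_factor:
  assumes qd: "\<forall>i. q i i = 1" and qinv: "\<forall>i j. q i j * q j i = 1"
    and all: "\<forall>i j k. distinct [i, j, k] \<longrightarrow> trivial_triangle q i j k"
  shows "q r j = q i j * q r i"
proof (cases "distinct [r, i, j]")
  case True
  then have "q r i * q i j * q j r = 1" using all unfolding trivial_triangle_def by blast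
  then have "q r j = q r j * (q r i * q i j * q j r)" by simp
  also have "\<dots> = (q r j * q j r) * (q i j * q r i)" by (simp add: mult_ac)
  finally show ?thesis using qinv by simp
next
  case False
  then have "r = i \<or> i = j \<or> r = j" by auto
  then show ?thesis using qd qinv by (auto simp: mult.commute)
qed

lemma Hilb1_initial_eq_diag_quartic_zero_set:
  fixes q :: "4 \<Rightarrow> 4 \<Rightarrow> complex"
  assumes q4: "\<forall>i j. q i j ^ 4 = 1" and factor: "\<forall>i j. q r j = q i j * q r i"
  shows "(\<lambda>P. P 0) ` Hilb1 q = quartic_zero_set (diag_quartic (\<lambda>k. q r k ^ 2))"
proof (intro equalityI subsetI)
  fix x assume "x \<in> (\<lambda>P. P 0) ` Hilb1 q"
  then obtain \<xi> where \<xi>: "point_seq q \<xi>" and x: "x = proj_class (\<xi> 0)"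
    unfolding Hilb1_def by auto
  obtain i where i: "\<xi> 0 $ i \<noteq> 0" using point_seq_nonzero[OF \<xi>, of 0] by (auto simp: vec_eq_iff)
  have rescale: "q r k ^ 2 * w = q r i ^ 2 * (q i k ^ 2 * w)" for k w
  proof -
    have "q r k = q i k * q r i" using factor by blast
    then show ?thesis by (simp only: power_mult_distrib mult_ac)
  qed
  have "(\<Sum>k\<in>UNIV. q r k ^ 2 * \<xi> 0 $ k ^ 4) = q r i ^ 2 * (\<Sum>k\<in>UNIV. q i k ^ 2 * \<xi> 0 $ k ^ 4)"
    unfolding sum_distrib_left by (intro sum.cong refl rescale)
  also have "\<dots> = 0" using point_seq_weighted_quartic[OF _ \<xi> i] q4 by simp
  finally show "x \<in> quartic_zero_set (diag_quartic (\<lambda>k. q r k ^ 2))"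
    unfolding quartic_zero_set_def quartic_eval_diag_quartic
    using x point_seq_nonzero[OF \<xi>] by blast
next
  fix x assume "x \<in> quartic_zero_set (diag_quartic (\<lambda>k. q r k ^ 2))"
  then obtain v where v: "v \<noteq> 0" "(\<Sum>k\<in>UNIV. q r k ^ 2 * v $ k ^ 4) = 0" "x = proj_class v"
    unfolding quartic_zero_set_def quartic_eval_diag_quartic by blast
  have "point_seq q (orbit_seq (q r) v)"
    using v(1,2) q4 factor by (intro point_seq_orbit_seq) auto
  from point_seq_in_Hilb1[OF this] show "x \<in> (\<lambda>P. P 0) ` Hilb1 q"
    by (rule rev_image_eqI) (simp add: v(3))
qed

lemma sum_UNIV_pair:
  fixes f :: "'a::finite \<Rightarrow> 'b::comm_monoid_add"
  assumes "i \<noteq> j" and "\<forall>k. k \<noteq> i \<longrightarrow> k \<noteq> j \<longrightarrow> f k = 0"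
  shows "sum f UNIV = f i + f j"
proof -
  have "sum f UNIV = sum f {i, j}" by (rule sum.mono_neutral_right) (use assms in auto)
  then show ?thesis using assms(1) by simp
qed

definition index_pairs :: "(4 \<times> 4) set" where
  "index_pairs = {(1, 2), (1, 3), (1, 4), (2, 3), (2, 4), (3, 4)}"

lemma numerals_4_neq:
  "(1::4) \<noteq> 2" "(1::4) \<noteq> 3" "(1::4) \<noteq> 4" "(2::4) \<noteq> 3" "(2::4) \<noteq> 4" "(3::4) \<noteq> 4"
  by simp_all

lemma finite_index_pairs: "finite index_pairs"
  unfolding index_pairs_def by simp

lemma card_index_pairs: "card index_pairs = 6"
  unfolding index_pairs_def by (simp add: numerals_4_neq)

lemma index_pairs_neq: "(i, j) \<in> index_pairs \<Longrightarrow> i \<noteq> j"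
  unfolding index_pairs_def using numerals_4_neq by auto

lemma index_pairs_asym: "(i, j) \<in> index_pairs \<Longrightarrow> (j, i) \<notin> index_pairs"
  unfolding index_pairs_def
  by (simp only: insert_iff empty_iff prod.inject; elim disjE conjE;
      simp add: numerals_4_neq numerals_4_neq[symmetric])

lemma index_pairs_total: "i \<noteq> j \<Longrightarrow> (i, j) \<in> index_pairs \<or> (j, i) \<in> index_pairs"
  unfolding index_pairs_def using exhaust_4[of i] exhaust_4[of j] numerals_4_neq by auto

definition pair_vec :: "4 \<Rightarrow> 4 \<Rightarrow> complex \<Rightarrow> cvec4" where
  "pair_vec i j b = (\<chi> k. if k = i then 1 else if k = j then b else 0)"

lemma pair_vec_component [simp]: "pair_vec i j b $ k = (if k = i then 1 else if k = j then b else 0)"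
  by (simp add: pair_vec_def)

lemma pair_vec_support: "i \<noteq> j \<Longrightarrow> b \<noteq> 0 \<Longrightarrow> pair_vec i j b $ k \<noteq> 0 \<longleftrightarrow> k = i \<or> k = j"
  by simp

definition pair_params :: "(4 \<Rightarrow> 4 \<Rightarrow> complex) \<Rightarrow> ((4 \<times> 4) \<times> complex) set" where
  "pair_params q = Sigma index_pairs (\<lambda>(i, j). {b. b ^ 4 = - (q i j ^ 2)})"

definition pair_point :: "(4 \<Rightarrow> 4 \<Rightarrow> complex) \<Rightarrow> (4 \<times> 4) \<times> complex \<Rightarrow> nat \<Rightarrow> cvec4 set" where
  "pair_point q = (\<lambda>((i, j), b) n. proj_class (orbit_seq (q i) (pair_vec i j b) n))"

lemma finite_card_pair_params:
  assumes q4: "\<forall>i j. q i j ^ 4 = 1"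
  shows "finite (pair_params q)" and "card (pair_params q) = 24"
proof -
  have "- (q i j ^ 2) \<noteq> 0" for i j using q4[rule_format, of i j] by auto
  then have roots: "card {b. b ^ 4 = - (q i j ^ 2)} = 4" for i j by (simp add: card_nth_roots)
  then have finite_roots: "finite {b. b ^ 4 = - (q i j ^ 2)}" for i j
    by (metis card.infinite zero_neq_numeral)
  show "finite (pair_params q)"
    unfolding pair_params_def using finite_index_pairs finite_roots by (intro finite_SigmaI) auto
  have "card (pair_params q) = (\<Sum>p\<in>index_pairs. card ((\<lambda>(i, j). {b. b ^ 4 = - (q i j ^ 2)}) p))"
    unfolding pair_params_def using finite_index_pairs finite_roots by (intro card_SigmaI) auto
  also have "\<dots> = 24" using roots card_index_pairs by (simp add: split_def)
  finally show "card (pair_params q) = 24" .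
qed

lemma point_seq_pair_vec:
  fixes q :: "4 \<Rightarrow> 4 \<Rightarrow> complex"
  assumes q4: "\<forall>i j. q i j ^ 4 = 1" and qd: "\<forall>i. q i i = 1" and qinv: "\<forall>i j. q i j * q j i = 1"
    and ij: "i \<noteq> j" and b: "b ^ 4 = - (q i j ^ 2)"
  shows "point_seq q (orbit_seq (q i) (pair_vec i j b))"
proof (rule point_seq_orbit_seq)
  show "\<forall>k. q i k ^ 4 = 1" using q4 by blast
  show "pair_vec i j b \<noteq> 0" by (auto simp: vec_eq_iff)
  have "q j i * q i j = 1" using qinv by blast
  then show "\<forall>i' j'. pair_vec i j b $ i' \<noteq> 0 \<longrightarrow> pair_vec i j b $ j' \<noteq> 0 \<longrightarrow> q i j' = q i' j' * q i i'"
    using qd ij by (auto simp: mult.commute)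
  have "(\<Sum>k\<in>UNIV. q i k ^ 2 * pair_vec i j b $ k ^ 4) = q i i ^ 2 + q i j ^ 2 * b ^ 4"
    using ij by (subst sum_UNIV_pair[OF ij]) auto
  also have "\<dots> = 1 - q i j ^ 4" using qd b by (simp add: power2_eq_square power4_eq_xxxx)
  finally show "(\<Sum>k\<in>UNIV. q i k ^ 2 * pair_vec i j b $ k ^ 4) = 0" using q4 by simp
qed

lemma pair_point_in_Hilb1:
  fixes q :: "4 \<Rightarrow> 4 \<Rightarrow> complex"
  assumes q4: "\<forall>i j. q i j ^ 4 = 1" and qd: "\<forall>i. q i i = 1" and qinv: "\<forall>i j. q i j * q j i = 1"
    and "x \<in> pair_params q"
  shows "pair_point q x \<in> Hilb1 q"
proof -
  obtain i j b where x: "x = ((i, j), b)" and "(i, j) \<in> index_pairs" "b ^ 4 = - (q i j ^ 2)"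
    using assms(4) unfolding pair_params_def by auto
  then have "point_seq q (orbit_seq (q i) (pair_vec i j b))"
    using point_seq_pair_vec[OF q4 qd qinv] index_pairs_neq by blast
  then show ?thesis unfolding x pair_point_def by (simp add: point_seq_in_Hilb1)
qed

lemma inj_on_pair_point:
  fixes q :: "4 \<Rightarrow> 4 \<Rightarrow> complex"
  assumes q4: "\<forall>i j. q i j ^ 4 = 1"
  shows "inj_on (pair_point q) (pair_params q)"
proof (rule inj_onI)
  fix x x' assume "x \<in> pair_params q" "x' \<in> pair_params q" and eq: "pair_point q x = pair_point q x'"
  then obtain i j b i' j' b' where x: "x = ((i, j), b)" "(i, j) \<in> index_pairs" "b ^ 4 = - (q i j ^ 2)"
    and x': "x' = ((i', j'), b')" "(i', j') \<in> index_pairs" "b' ^ 4 = - (q i' j' ^ 2)"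
    unfolding pair_params_def by auto
  have "q i j \<noteq> 0" "q i' j' \<noteq> 0" using q4 by (metis power_0_left zero_neq_numeral zero_neq_one)+
  then have "b \<noteq> 0" "b' \<noteq> 0" using x(3) x'(3) by auto
  have "proj_class (pair_vec i j b) = proj_class (pair_vec i' j' b')"
    using fun_cong[OF eq, of 0] unfolding x x' pair_point_def by simp
  then obtain c where c: "c \<noteq> 0" "pair_vec i' j' b' = c *s pair_vec i j b"
    using proj_class_eq_imp_smult by blast
  then have "pair_vec i' j' b' $ k \<noteq> 0 \<longleftrightarrow> pair_vec i j b $ k \<noteq> 0" for k by simp
  then have "k = i' \<or> k = j' \<longleftrightarrow> k = i \<or> k = j" for k
    using pair_vec_support index_pairs_neq x(2) x'(2) \<open>b \<noteq> 0\<close> \<open>b' \<noteq> 0\<close> by metis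
  then have "i' = i \<and> j' = j \<or> i' = j \<and> j' = i" using index_pairs_neq[OF x(2)] by metis
  then have "i' = i" "j' = j" using index_pairs_asym x(2) x'(2) by auto
  moreover have "c = 1" using c(2)[THEN arg_cong, of "\<lambda>v. v $ i"] \<open>i' = i\<close> by simp
  ultimately have "b' = b" using c(2)[THEN arg_cong, of "\<lambda>v. v $ j"] index_pairs_neq[OF x(2)] by simp
  then show "x = x'" using x(1) x'(1) \<open>i' = i\<close> \<open>j' = j\<close> by simp
qed

lemma point_seq_pair_support:
  fixes q :: "4 \<Rightarrow> 4 \<Rightarrow> complex"
  assumes q4: "\<forall>i j. q i j ^ 4 = 1" and qd: "\<forall>i. q i i = 1" and \<xi>: "point_seq q \<xi>"
    and ij: "i \<noteq> j" and i: "\<xi> 0 $ i \<noteq> 0" and j: "\<xi> 0 $ j \<noteq> 0"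
    and others: "\<forall>k. k \<noteq> i \<longrightarrow> k \<noteq> j \<longrightarrow> \<xi> 0 $ k = 0"
  shows "(\<lambda>n. proj_class (\<xi> n)) = pair_point q ((i, j), \<xi> 0 $ j / \<xi> 0 $ i)"
    and "(\<xi> 0 $ j / \<xi> 0 $ i) ^ 4 = - (q i j ^ 2)"
proof -
  define b where "b = \<xi> 0 $ j / \<xi> 0 $ i"
  have \<xi>0: "\<xi> 0 = \<xi> 0 $ i *s pair_vec i j b"
    using i others by (auto simp: vec_eq_iff b_def)
  have "proj_class (\<xi> n) = proj_class (orbit_seq (q i) (pair_vec i j b) n)" for n
    using proj_class_point_seq[OF \<xi> i, of n] proj_class_smult[OF i]
    by (subst (asm) \<xi>0) (simp add: orbit_seq_smult)
  then show "(\<lambda>n. proj_class (\<xi> n)) = pair_point q ((i, j), \<xi> 0 $ j / \<xi> 0 $ i)"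
    by (simp add: pair_point_def b_def)
  have "0 = (\<Sum>k\<in>UNIV. q i k ^ 2 * \<xi> 0 $ k ^ 4)"
    using point_seq_weighted_quartic[OF _ \<xi> i] q4 by simp
  also have "\<dots> = \<xi> 0 $ i ^ 4 * (1 + q i j ^ 2 * b ^ 4)"
    using qd others i by (subst sum_UNIV_pair[OF ij]) (auto simp: b_def field_simps)
  finally have "q i j ^ 2 * b ^ 4 = - 1"
    using i by (simp add: add_eq_0_iff)
  have "b ^ 4 = q i j ^ 2 * (q i j ^ 2 * b ^ 4)"
    using q4[rule_format, of i j] by (simp flip: mult.assoc power_add)
  also have "\<dots> = - (q i j ^ 2)" using \<open>q i j ^ 2 * b ^ 4 = - 1\<close> by simp
  finally show "(\<xi> 0 $ j / \<xi> 0 $ i) ^ 4 = - (q i j ^ 2)" by (simp add: b_def)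
qed

lemma Hilb1_subset_pair_point:
  fixes q :: "4 \<Rightarrow> 4 \<Rightarrow> complex"
  assumes q4: "\<forall>i j. q i j ^ 4 = 1" and qd: "\<forall>i. q i i = 1"
    and no_triangle: "\<forall>i j k. distinct [i, j, k] \<longrightarrow> \<not> trivial_triangle q i j k"
  shows "Hilb1 q \<subseteq> pair_point q ` pair_params q"
proof
  fix P assume "P \<in> Hilb1 q"
  then obtain \<xi> where \<xi>: "point_seq q \<xi>" and P: "P = (\<lambda>n. proj_class (\<xi> n))"
    unfolding Hilb1_def by auto
  obtain i where i: "\<xi> 0 $ i \<noteq> 0" using point_seq_nonzero[OF \<xi>, of 0] by (auto simp: vec_eq_iff)
  obtain j where ij: "i \<noteq> j" and j: "\<xi> 0 $ j \<noteq> 0"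
  proof (rule ccontr)
    note found = that
    assume "\<not> thesis"
    then have "\<xi> 0 $ k = 0" if "k \<noteq> i" for k using found[of k] that by metis
    then have "(\<Sum>k\<in>UNIV. q i k ^ 2 * \<xi> 0 $ k ^ 4) = (\<Sum>k\<in>{i}. q i k ^ 2 * \<xi> 0 $ k ^ 4)"
      by (intro sum.mono_neutral_right) auto
    then show False using point_seq_weighted_quartic[OF _ \<xi> i] q4 qd i by simp
  qed
  have others: "\<forall>k. k \<noteq> i \<longrightarrow> k \<noteq> j \<longrightarrow> \<xi> 0 $ k = 0"
    using point_seq_trivial_triangle[OF \<xi> i j] no_triangle ij by (metis distinct_length_2_or_more distinct_singleton)
  consider "(i, j) \<in> index_pairs" | "(j, i) \<in> index_pairs" using index_pairs_total[OF ij] by blast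
  then show "P \<in> pair_point q ` pair_params q"
  proof cases
    case 1
    note pair = point_seq_pair_support[OF q4 qd \<xi> ij i j others]
    show ?thesis unfolding P pair(1) using 1 pair(2) by (auto simp: pair_params_def)
  next
    case 2
    have "\<forall>k. k \<noteq> j \<longrightarrow> k \<noteq> i \<longrightarrow> \<xi> 0 $ k = 0" using others by blast
    note pair = point_seq_pair_support[OF q4 qd \<xi> ij[symmetric] j i this]
    show ?thesis unfolding P pair(1) using 2 pair(2) by (auto simp: pair_params_def)
  qed
qed

theorem proposition3p4:
  fixes q :: "4 \<Rightarrow> 4 \<Rightarrow> complex"
  assumes "\<forall>i j. q i j ^ 4 = 1"
    and "\<forall>i. q i i = 1"
    and "\<forall>i j. q i j * q j i = 1"
    and "\<forall>j j'. (\<Prod>i\<in>UNIV. q i j) = (\<Prod>i\<in>UNIV. q i j')"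
  shows "(\<exists>c. smooth_quartic c \<and> inj_on (\<lambda>P. P 0) (Hilb1 q) \<and>
              (\<lambda>P. P 0) ` Hilb1 q = quartic_zero_set c)
         \<or> (finite (Hilb1 q) \<and> card (Hilb1 q) = 24)"
proof (cases "\<forall>i j k. distinct [i, j, k] \<longrightarrow> trivial_triangle q i j k")
  case True
  then have factor: "\<forall>i j. q 1 j = q i j * q 1 i"
    using trivial_triangles_imp_factor[OF assms(2,3)] by blast
  have "q 1 k \<noteq> 0" for k using assms(1)[rule_format, of 1 k] by auto
  then have "smooth_quartic (diag_quartic (\<lambda>k. q 1 k ^ 2))"
    by (intro smooth_quartic_diag_quartic) simp
  then show ?thesis
    using Hilb1_initial_eq_diag_quartic_zero_set[OF assms(1) factor] inj_on_Hilb1_initial by blast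
next
  case False
  then have "\<forall>i j k. distinct [i, j, k] \<longrightarrow> \<not> trivial_triangle q i j k"
    using trivial_triangles_all_or_none[OF assms] by blast
  then have "Hilb1 q = pair_point q ` pair_params q"
    using Hilb1_subset_pair_point[OF assms(1,2)] pair_point_in_Hilb1[OF assms(1-3)] by blast
  then have "bij_betw (pair_point q) (pair_params q) (Hilb1 q)"
    using inj_on_pair_point[OF assms(1)] by (simp add: bij_betw_def)
  then show ?thesis
    using finite_card_pair_params[OF assms(1)] bij_betw_finite bij_betw_same_card by metis
qed

end
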